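(* Let $\mathbb{C}$ be a modified category of interest, let $(P,R,\partial)$ be a crossed module in $\mathbb{C}$ and let $\phi:S\to R$ be a morphism in $\mathbb{C}$. Put $\phi^\star(P)=P\times_R S=\{(p,s)\in P\times S\mid\partial(p)=\phi(s)\}$, let $\partial^\star:\phi^\star(P)\to S$ be given by $\partial^\star(p,s)=s$, let $S$ act on $\phi^\star(P)$ by $$t\cdot(p,s)=(\phi(t)\cdot p,\;t+s-t),\qquad t\ast(p,s)=(\phi(t)\ast p,\;t\ast s)$$ for $t\in S$, $(p,s)\in\phi^\star(P)$, $\ast\in\Omega_2'$, and let $\phi':\phi^\star(P)\to P$ be given by $\phi'(p,s)=p$. Then $(\phi^\star(P),S,\partial^\star)$ is a crossed module, $(\phi',\phi):(\phi^\star(P),S,\partial^\star)\to(P,R,\partial)$ is a crossed module morphism, and it is the pullback crossed module of $(P,R,\partial)$ along $\phi$; that is, for every crossed module morphism of the form $(f,\phi):(X,S,\mu)\to(P,R,\partial)$ there exists a unique crossed module morphism of the form $(f^\star,\mathrm{id}_S):(X,S,\mu)\to(\phi^\star(P),S,\partial^\star)$ such that $(\phi',\phi)\circ(f^\star,\mathrm{id}_S)=(f,\phi)$.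
   Context: **Modified category of interest (MCI).** Let $\mathbb{C}$ be a category of groups with a set of operations $\Omega$ and a set of identities $\mathbb{E}$ including the group identities. Let $\Omega_i$ be the set of $i$-ary operations in $\Omega$. $\mathbb{C}$ is an MCI if: (a) $\Omega=\Omega_0\cup\Omega_1\cup\Omega_2$; (b) the group operations (written additively, $0,-,+$, not necessarily commutative) are elements of $\Omega_0,\Omega_1,\Omega_2$ respectively; put $\Omega_2'=\Omega_2\setminus\{+\}$, $\Omega_1'=\Omega_1\setminus\{-\}$; if $\ast\in\Omega_2'$ then $\Omega_2'$ also contains $\ast^\circ$ defined by $x\ast^\circ y=y\ast x$; and $\Omega_0=\{0\}$; (c) for each $\ast\in\Omega_2'$, $\mathbb{E}$ includes $x\ast(y+z)=x\ast y+x\ast z$; (d) for each $\omega\in\Omega_1'$ and $\ast\in\Omega_2'$, $\mathbb{E}$ includes $\omega(x+y)=\omega(x)+\omega(y)$ and either $\omega(x\ast y)=\omega(x)\ast\omega(y)$ or $\omega(x\ast y)=\omega(x)\ast y$; and for every object $C$ and $x_1,x_2,x_3\in C$: (e) $x_1+(x_2\ast x_3)=(x_2\ast x_3)+x_1$ for each $\ast\in\Omega_2'$; (f) for each ordered pair $(\ast,\overline{\ast})\in\Omega_2'\times\Omega_2'$ there is a word $W$ such that $(x_1\ast x_2)\,\overline{\ast}\,x_3=W\big(x_1(x_2x_3),x_1(x_3x_2),(x_2x_3)x_1,(x_3x_2)x_1,x_2(x_1x_3),x_2(x_3x_1),(x_1x_3)x_2,(x_3x_1)x_2\big)$, where each juxtaposition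 represents an operation in $\Omega_2'$. Morphisms of $\mathbb{C}$ are maps preserving $+$ and all $\ast\in\Omega_2'$ and commuting with all $\omega\in\Omega_1'$. Products and fiber products in $\mathbb{C}$ carry componentwise operations. **Derived actions.** A split extension of $B$ by $A$ is a sequence $0\to A\xrightarrow{i}E\xrightarrow{p}B\to 0$ in $\mathbb{C}$ with $p$ surjective, $i$ the kernel of $p$, and a morphism $s:B\to E$ with $ps=1_B$. It induces the action of $B$ on $A$ given by $b\cdot a=s(b)+a-s(b)$ and $b\ast a=s(b)\ast a$ for $b\in B$, $a\in A$, $\ast\in\Omega_2'$. Actions arising this way are called derived actions. **Crossed modules.** A crossed module $(C_1,C_0,\partial)$ in $\mathbb{C}$ is a morphism $\partial:C_1\to C_0$ with a derived action of $C_0$ on $C_1$ such that for all $c_0\in C_0$, $c_1,c_1'\in C_1$, $\ast\in\Omega_2'$: (XM1) $\partial(c_0\cdot c_1)=c_0+\partial(c_1)-c_0$ and $\partial(c_0\ast c_1)=c_0\ast\partial(c_1)$; (XM2) $\partial(c_1)\cdot c_1'=c_1+c_1'-c_1$ and $\partial(c_1)\ast c_1'=c_1\ast c_1'$. A morphism $(C_1,C_0,\partial)\to(C_1',C_0',\partial')$ is a pair $(\mu_1,\mu_0)$ of morphisms $\mu_1:C_1\to C_1'$, $\mu_0:C_0\to C_0'$ of $\mathbb{C}$ with $\partial'\mu_1=\mu_0\partial$, $\mu_1(c_0\cdot c_1)=\mu_0(c_0)\cdot\mu_1(c_1)$ and $\mu_1(c_0\ast c_1)=\mu_0(c_0)\ast\mu_1(c_1)$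 for all $c_0,c_1,\ast$.
   Formalization: In condition (d), additivity ω(x+y)=ω(x)+ω(y) is required of every ω in Ω₁′ even when Ω₂′ is empty; read literally, (d) is then vacuous and the claim can fail, e.g. for groups with ω(x)+ω(x)=x and ω(0)=0. *)

theory Defs
  imports "HOL-Algebra.Group" "HOL-Algebra.Coset"
begin

text \<open>
  Groups with operations. The underlying group is a group of HOL-Algebra, so the additive,
  not necessarily commutative notation \<open>x + y\<close>, \<open>0\<close>, \<open>-x\<close> of the literature reads
  \<open>x \<otimes> y\<close>, \<open>\<one>\<close>, \<open>inv x\<close> here. The types \<open>'u\<close> and \<open>'b\<close> are reservoirs of
  symbols for the further unary and binary operations; the symbols in use are singled out
  by a signature below, so that either kind may be absent.
\<close>

record ('a, 'u, 'b) alg = "'a monoid" +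
  unop :: "'u \<Rightarrow> 'a \<Rightarrow> 'a"
  binop :: "'b \<Rightarrow> 'a \<Rightarrow> 'a \<Rightarrow> 'a"

datatype ('u, 'b) trm =
    TVar nat
  | TZero
  | TNeg "('u, 'b) trm"
  | TPlus "('u, 'b) trm" "('u, 'b) trm"
  | TUn 'u "('u, 'b) trm"
  | TBin 'b "('u, 'b) trm" "('u, 'b) trm"

primrec tvars :: "('u, 'b) trm \<Rightarrow> nat set" where
  "tvars (TVar n) = {n}"
| "tvars TZero = {}"
| "tvars (TNeg t) = tvars t"
| "tvars (TPlus t t') = tvars t \<union> tvars t'"
| "tvars (TUn u t) = tvars t"
| "tvars (TBin b t t') = tvars t \<union> tvars t'"

primrec tsubst :: "(nat \<Rightarrow> ('u, 'b) trm) \<Rightarrow> ('u, 'b) trm \<Rightarrow> ('u, 'b) trm" where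
  "tsubst \<sigma> (TVar n) = \<sigma> n"
| "tsubst \<sigma> TZero = TZero"
| "tsubst \<sigma> (TNeg t) = TNeg (tsubst \<sigma> t)"
| "tsubst \<sigma> (TPlus t t') = TPlus (tsubst \<sigma> t) (tsubst \<sigma> t')"
| "tsubst \<sigma> (TUn u t) = TUn u (tsubst \<sigma> t)"
| "tsubst \<sigma> (TBin b t t') = TBin b (tsubst \<sigma> t) (tsubst \<sigma> t')"

primrec eval :: "('a, 'u, 'b) alg \<Rightarrow> (nat \<Rightarrow> 'a) \<Rightarrow> ('u, 'b) trm \<Rightarrow> 'a" where
  "eval G v (TVar n) = v n"
| "eval G v TZero = \<one>\<^bsub>G\<^esub>"
| "eval G v (TNeg t) = inv\<^bsub>G\<^esub> (eval G v t)"
| "eval G v (TPlus t t') = eval G v t \<otimes>\<^bsub>G\<^esub> eval G v t'"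
| "eval G v (TUn u t) = unop G u (eval G v t)"
| "eval G v (TBin b t t') = binop G b (eval G v t) (eval G v t')"

text \<open>
  \<open>unary V\<close> and \<open>binary V\<close> are \<open>\<Omega>\<^sub>1'\<close> and \<open>\<Omega>\<^sub>2'\<close>, that is, the operations other than
  \<open>-\<close> and \<open>+\<close>; the only constant is \<open>0\<close>. The group identities need not be listed in
  \<open>identities V\<close>, because they are part of being an object.
\<close>

record ('u, 'b) variety =
  unary :: "'u set"
  binary :: "'b set"
  identities :: "(('u, 'b) trm \<times> ('u, 'b) trm) set"

primrec wf_trm :: "('u, 'b) variety \<Rightarrow> ('u, 'b) trm \<Rightarrow> bool" where
  "wf_trm V (TVar n) \<longleftrightarrow> True"
| "wf_trm V TZero \<longleftrightarrow> True"
| "wf_trm V (TNeg t) \<longleftrightarrow> wf_trm V t"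
| "wf_trm V (TPlus t t') \<longleftrightarrow> wf_trm V t \<and> wf_trm V t'"
| "wf_trm V (TUn u t) \<longleftrightarrow> u \<in> unary V \<and> wf_trm V t"
| "wf_trm V (TBin b t t') \<longleftrightarrow> b \<in> binary V \<and> wf_trm V t \<and> wf_trm V t'"

definition wf_variety :: "('u, 'b) variety \<Rightarrow> bool" where
  "wf_variety V \<longleftrightarrow> (\<forall>(l, r)\<in>identities V. wf_trm V l \<and> wf_trm V r)"

definition satisfies ::
    "('a, 'u, 'b) alg \<Rightarrow> ('u, 'b) trm \<Rightarrow> ('u, 'b) trm \<Rightarrow> bool" where
  "satisfies G l r \<longleftrightarrow> (\<forall>v \<in> UNIV \<rightarrow> carrier G. eval G v l = eval G v r)"

definition object :: "('u, 'b) variety \<Rightarrow> ('a, 'u, 'b) alg \<Rightarrow> bool" where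
  "object V G \<longleftrightarrow> group G
     \<and> (\<forall>u\<in>unary V. unop G u \<in> carrier G \<rightarrow> carrier G)
     \<and> (\<forall>b\<in>binary V. binop G b \<in> carrier G \<rightarrow> carrier G \<rightarrow> carrier G)
     \<and> (\<forall>(l, r)\<in>identities V. satisfies G l r)"

definition mor ::
    "('u, 'b) variety \<Rightarrow> ('a, 'u, 'b) alg \<Rightarrow> ('c, 'u, 'b) alg \<Rightarrow> ('a \<Rightarrow> 'c) set" where
  "mor V G H = {f \<in> hom G H.
     (\<forall>u\<in>unary V. \<forall>x\<in>carrier G. f (unop G u x) = unop H u (f x)) \<and>
     (\<forall>b\<in>binary V. \<forall>x\<in>carrier G. \<forall>y\<in>carrier G.
        f (binop G b x y) = binop H b (f x) (f y))}"

text \<open>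
  \<open>valid V l r\<close>: the identity \<open>l = r\<close> holds in every object. HOL cannot quantify over the
  carrier type, so the objects are taken over the type of terms. This is no restriction:
  the subobject generated by countably many elements has a copy over that type, see lemma
  \<open>valid_satisfies\<close> below.
\<close>

definition valid :: "('u, 'b) variety \<Rightarrow> ('u, 'b) trm \<Rightarrow> ('u, 'b) trm \<Rightarrow> bool" where
  "valid V l r \<longleftrightarrow>
     (\<forall>C :: (('u, 'b) trm, 'u, 'b) alg. object V C \<longrightarrow> satisfies C l r)"

abbreviation "tx \<equiv> TVar 0"
abbreviation "ty \<equiv> TVar 1"
abbreviation "tz \<equiv> TVar 2"

text \<open>
  The eight arguments of the word \<open>W\<close>. The sixteen juxtapositions may be sixteen different
  operations \<open>j 0, \<dots>, j 15\<close>.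
\<close>

definition mci_args :: "(nat \<Rightarrow> 'b) \<Rightarrow> ('u, 'b) trm list" where
  "mci_args j =
    [TBin (j 0) tx (TBin (j 1) ty tz),
     TBin (j 2) tx (TBin (j 3) tz ty),
     TBin (j 4) (TBin (j 5) ty tz) tx,
     TBin (j 6) (TBin (j 7) tz ty) tx,
     TBin (j 8) ty (TBin (j 9) tx tz),
     TBin (j 10) ty (TBin (j 11) tz tx),
     TBin (j 12) (TBin (j 13) tx tz) ty,
     TBin (j 14) (TBin (j 15) tz tx) ty]"

text \<open>
  Additivity of the operations in \<open>\<Omega>\<^sub>1'\<close> is required also when \<open>\<Omega>\<^sub>2'\<close> is empty: without it,
  pullbacks of crossed modules may fail to be crossed modules, for instance for groups with
  an operation \<open>\<omega>\<close> subject to \<open>\<omega>(x) + \<omega>(x) = x\<close> and \<open>\<omega>(0) = 0\<close>.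
\<close>

definition mci :: "('u, 'b) variety \<Rightarrow> bool" where
  "mci V \<longleftrightarrow> wf_variety V
    \<and> (\<forall>b\<in>binary V. \<exists>b'\<in>binary V. valid V (TBin b' tx ty) (TBin b ty tx))
    \<and> (\<forall>b\<in>binary V.
          (TBin b tx (TPlus ty tz), TPlus (TBin b tx ty) (TBin b tx tz)) \<in> identities V)
    \<and> (\<forall>u\<in>unary V.
          (TUn u (TPlus tx ty), TPlus (TUn u tx) (TUn u ty)) \<in> identities V)
    \<and> (\<forall>u\<in>unary V. \<forall>b\<in>binary V.
          (TUn u (TBin b tx ty), TBin b (TUn u tx) (TUn u ty)) \<in> identities V \<or>
          (TUn u (TBin b tx ty), TBin b (TUn u tx) ty) \<in> identities V)
    \<and> (\<forall>b\<in>binary V. valid V (TPlus tx (TBin b ty tz)) (TPlus (TBin b ty tz) tx))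
    \<and> (\<forall>b\<in>binary V. \<forall>c\<in>binary V.
          \<exists>W j. wf_trm V W \<and> tvars W \<subseteq> {..<8} \<and> j ` {..<16} \<subseteq> binary V \<and>
            valid V (TBin c (TBin b tx ty) tz) (tsubst (\<lambda>i. mci_args j ! i) W))"

definition fiber_product ::
    "('p, 'u, 'b) alg \<Rightarrow> ('s, 'u, 'b) alg \<Rightarrow> ('p \<Rightarrow> 'r) \<Rightarrow> ('s \<Rightarrow> 'r) \<Rightarrow>
     ('p \<times> 's, 'u, 'b) alg" where
  "fiber_product P S f g =
    \<lparr>carrier = {(p, s). p \<in> carrier P \<and> s \<in> carrier S \<and> f p = g s},
     monoid.mult = (\<lambda>(p, s) (p', s'). (p \<otimes>\<^bsub>P\<^esub> p', s \<otimes>\<^bsub>S\<^esub> s')),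
     one = (\<one>\<^bsub>P\<^esub>, \<one>\<^bsub>S\<^esub>),
     unop = (\<lambda>u (p, s). (unop P u p, unop S u s)),
     binop = (\<lambda>b (p, s) (p', s'). (binop P b p p', binop S b s s'))\<rparr>"

text \<open>
  \<open>act_dot \<alpha> b a\<close> is \<open>b \<cdot> a\<close>, and \<open>act_star \<alpha> c b a\<close> is \<open>b \<star> a\<close> for the binary operation
  \<open>\<star>\<close> named \<open>c\<close>.
\<close>

record ('y, 'x, 'b) act =
  act_dot :: "'y \<Rightarrow> 'x \<Rightarrow> 'x"
  act_star :: "'b \<Rightarrow> 'y \<Rightarrow> 'x \<Rightarrow> 'x"

definition split_extension ::
    "('u, 'b) variety \<Rightarrow> ('x, 'u, 'b) alg \<Rightarrow> ('e, 'u, 'b) alg \<Rightarrow> ('y, 'u, 'b) alg \<Rightarrow>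
     ('x \<Rightarrow> 'e) \<Rightarrow> ('e \<Rightarrow> 'y) \<Rightarrow> ('y \<Rightarrow> 'e) \<Rightarrow> bool" where
  "split_extension V A E B i p s \<longleftrightarrow>
     object V A \<and> object V E \<and> object V B \<and>
     i \<in> mor V A E \<and> p \<in> mor V E B \<and> s \<in> mor V B E \<and>
     p ` carrier E = carrier B \<and>
     inj_on i (carrier A) \<and> i ` carrier A = kernel E B p \<and>
     (\<forall>b\<in>carrier B. p (s b) = b)"

definition induces_action ::
    "('u, 'b) variety \<Rightarrow> ('x, 'u, 'b) alg \<Rightarrow> ('e, 'u, 'b) alg \<Rightarrow> ('y, 'u, 'b) alg \<Rightarrow>
     ('x \<Rightarrow> 'e) \<Rightarrow> ('y \<Rightarrow> 'e) \<Rightarrow> ('y, 'x, 'b) act \<Rightarrow> bool" where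
  "induces_action V A E B i s \<alpha> \<longleftrightarrow>
     (\<forall>b\<in>carrier B. \<forall>a\<in>carrier A.
        act_dot \<alpha> b a \<in> carrier A \<and>
        i (act_dot \<alpha> b a) = s b \<otimes>\<^bsub>E\<^esub> i a \<otimes>\<^bsub>E\<^esub> inv\<^bsub>E\<^esub> (s b) \<and>
        (\<forall>c\<in>binary V.
           act_star \<alpha> c b a \<in> carrier A \<and>
           i (act_star \<alpha> c b a) = binop E c (s b) (i a)))"

text \<open>
  Every split extension of \<open>B\<close> by \<open>A\<close> is in bijection with \<open>A \<times> B\<close>, so there is no loss in
  taking the middle object over the product type, see lemma \<open>derived_actionI\<close> below.
\<close>

definition derived_action ::
    "('u, 'b) variety \<Rightarrow> ('y, 'u, 'b) alg \<Rightarrow> ('x, 'u, 'b) alg \<Rightarrow>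
     ('y, 'x, 'b) act \<Rightarrow> bool" where
  "derived_action V B A \<alpha> \<longleftrightarrow>
     (\<exists>(E :: ('x \<times> 'y, 'u, 'b) alg) i p s.
        split_extension V A E B i p s \<and> induces_action V A E B i s \<alpha>)"

text \<open>A crossed module is written \<open>(C\<^sub>1, C\<^sub>0, \<partial>, \<alpha>)\<close> with its action \<open>\<alpha>\<close> made explicit.\<close>

type_synonym ('x, 'y, 'u, 'b) xmod =
  "('x, 'u, 'b) alg \<times> ('y, 'u, 'b) alg \<times> ('x \<Rightarrow> 'y) \<times> ('y, 'x, 'b) act"

fun crossed_module :: "('u, 'b) variety \<Rightarrow> ('x, 'y, 'u, 'b) xmod \<Rightarrow> bool" where
  "crossed_module V (C1, C0, d, \<alpha>) \<longleftrightarrow>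
     object V C1 \<and> object V C0 \<and> d \<in> mor V C1 C0 \<and> derived_action V C0 C1 \<alpha> \<and>
     (\<forall>c0\<in>carrier C0. \<forall>c1\<in>carrier C1.
        d (act_dot \<alpha> c0 c1) = c0 \<otimes>\<^bsub>C0\<^esub> d c1 \<otimes>\<^bsub>C0\<^esub> inv\<^bsub>C0\<^esub> c0 \<and>
        (\<forall>b\<in>binary V. d (act_star \<alpha> b c0 c1) = binop C0 b c0 (d c1))) \<and>
     (\<forall>c1\<in>carrier C1. \<forall>c1'\<in>carrier C1.
        act_dot \<alpha> (d c1) c1' = c1 \<otimes>\<^bsub>C1\<^esub> c1' \<otimes>\<^bsub>C1\<^esub> inv\<^bsub>C1\<^esub> c1 \<and>
        (\<forall>b\<in>binary V. act_star \<alpha> b (d c1) c1' = binop C1 b c1 c1'))"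

fun xmod_morphism ::
    "('u, 'b) variety \<Rightarrow> ('x, 'y, 'u, 'b) xmod \<Rightarrow> ('x', 'y', 'u, 'b) xmod \<Rightarrow>
     ('x \<Rightarrow> 'x') \<times> ('y \<Rightarrow> 'y') \<Rightarrow> bool" where
  "xmod_morphism V (C1, C0, d, \<alpha>) (C1', C0', d', \<alpha>') (m1, m0) \<longleftrightarrow>
     m1 \<in> mor V C1 C1' \<and> m0 \<in> mor V C0 C0' \<and>
     (\<forall>c1\<in>carrier C1. d' (m1 c1) = m0 (d c1)) \<and>
     (\<forall>c0\<in>carrier C0. \<forall>c1\<in>carrier C1.
        m1 (act_dot \<alpha> c0 c1) = act_dot \<alpha>' (m0 c0) (m1 c1) \<and>
        (\<forall>b\<in>binary V. m1 (act_star \<alpha> b c0 c1) = act_star \<alpha>' b (m0 c0) (m1 c1)))"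

fun xmod_comp ::
    "('x' \<Rightarrow> 'x'') \<times> ('y' \<Rightarrow> 'y'') \<Rightarrow> ('x \<Rightarrow> 'x') \<times> ('y \<Rightarrow> 'y') \<Rightarrow>
     ('x \<Rightarrow> 'x'') \<times> ('y \<Rightarrow> 'y'')" where
  "xmod_comp (g1, g0) (f1, f0) = (g1 \<circ> f1, g0 \<circ> f0)"

text \<open>Equality of maps out of a crossed module: agreement on the two carriers.\<close>

fun xmod_mor_eq ::
    "('x, 'y, 'u, 'b) xmod \<Rightarrow> ('x \<Rightarrow> 'x') \<times> ('y \<Rightarrow> 'y') \<Rightarrow>
     ('x \<Rightarrow> 'x') \<times> ('y \<Rightarrow> 'y') \<Rightarrow> bool" where
  "xmod_mor_eq (C1, C0, d, \<alpha>) (f1, f0) (g1, g0) \<longleftrightarrow>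
     (\<forall>x\<in>carrier C1. f1 x = g1 x) \<and> (\<forall>y\<in>carrier C0. f0 y = g0 y)"

definition pullback_action ::
    "('s, 'u, 'b) alg \<Rightarrow> ('r, 'p, 'b) act \<Rightarrow> ('s \<Rightarrow> 'r) \<Rightarrow> ('s, 'p \<times> 's, 'b) act" where
  "pullback_action S \<beta> \<phi> =
    \<lparr>act_dot = (\<lambda>t (p, s). (act_dot \<beta> (\<phi> t) p, t \<otimes>\<^bsub>S\<^esub> s \<otimes>\<^bsub>S\<^esub> inv\<^bsub>S\<^esub> t)),
     act_star = (\<lambda>b t (p, s). (act_star \<beta> b (\<phi> t) p, binop S b t s))\<rparr>"

fun pullback_xmod ::
    "('p, 'r, 'u, 'b) xmod \<Rightarrow> ('s, 'u, 'b) alg \<Rightarrow> ('s \<Rightarrow> 'r) \<Rightarrow> ('p \<times> 's, 's, 'u, 'b) xmod" where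
  "pullback_xmod (P, R, d, \<beta>) S \<phi> =
     (fiber_product P S d \<phi>, S, snd, pullback_action S \<beta> \<phi>)"


subsection \<open>The choice of carrier types is immaterial\<close>

definition transport ::
    "('a \<Rightarrow> 'c) \<Rightarrow> 'a set \<Rightarrow> ('a, 'u, 'b) alg \<Rightarrow> ('c, 'u, 'b) alg" where
  "transport h K G = (let k = inv_into K h in
    \<lparr>carrier = h ` K,
     monoid.mult = (\<lambda>x y. h (k x \<otimes>\<^bsub>G\<^esub> k y)),
     one = h \<one>\<^bsub>G\<^esub>,
     unop = (\<lambda>u x. h (unop G u (k x))),
     binop = (\<lambda>b x y. h (binop G b (k x) (k y)))\<rparr>)"

definition closed_subset :: "('u, 'b) variety \<Rightarrow> 'a set \<Rightarrow> ('a, 'u, 'b) alg \<Rightarrow> bool" where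
  "closed_subset V K G \<longleftrightarrow> subgroup K G \<and> (\<forall>u\<in>unary V. unop G u \<in> K \<rightarrow> K) \<and>
     (\<forall>b\<in>binary V. binop G b \<in> K \<rightarrow> K \<rightarrow> K)"

context
  fixes V :: "('u, 'b) variety" and G :: "('a, 'u, 'b) alg" and K and h :: "'a \<Rightarrow> 'c"
  assumes G: "object V G" and K: "closed_subset V K G" and h: "inj_on h K"
begin

lemma group_G: "group G" and sub_K: "subgroup K G"
  using G K by (auto simp: object_def closed_subset_def)

lemma transport_sel:
  "carrier (transport h K G) = h ` K"
  "\<one>\<^bsub>transport h K G\<^esub> = h \<one>\<^bsub>G\<^esub>"
  "x \<in> K \<Longrightarrow> y \<in> K \<Longrightarrow> h x \<otimes>\<^bsub>transport h K G\<^esub> h y = h (x \<otimes>\<^bsub>G\<^esub> y)"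
  "x \<in> K \<Longrightarrow> unop (transport h K G) u (h x) = h (unop G u x)"
  "x \<in> K \<Longrightarrow> y \<in> K \<Longrightarrow> binop (transport h K G) b (h x) (h y) = h (binop G b x y)"
  using h by (auto simp: transport_def Let_def)

lemma transport_group: "group (transport h K G)"
proof -
  interpret group G by (rule group_G)
  interpret K: subgroup K G by (rule sub_K)
  show ?thesis
  proof (rule groupI)
    fix x assume "x \<in> carrier (transport h K G)"
    then obtain a where a: "a \<in> K" "x = h a" by (auto simp: transport_sel)
    then show "\<exists>y\<in>carrier (transport h K G).
        y \<otimes>\<^bsub>transport h K G\<^esub> x = \<one>\<^bsub>transport h K G\<^esub>"
      by (intro bexI[of _ "h (inv\<^bsub>G\<^esub> a)"]) (auto simp: transport_sel)
  qed (auto simp: transport_sel m_assoc)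
qed

lemma transport_inv:
  assumes "x \<in> K"
  shows "inv\<^bsub>transport h K G\<^esub> (h x) = h (inv\<^bsub>G\<^esub> x)"
proof -
  interpret group G by (rule group_G)
  interpret K: subgroup K G by (rule sub_K)
  show ?thesis
    using assms by (intro group.inv_equality[OF transport_group]) (auto simp: transport_sel)
qed

lemma transport_eval:
  assumes "wf_trm V t" "\<And>n. w n \<in> K"
  shows "eval G w t \<in> K \<and> eval (transport h K G) (\<lambda>n. h (w n)) t = h (eval G w t)"
  using assms(1)
proof (induction t)
  case (TUn u t)
  then show ?case using K by (auto simp: transport_sel closed_subset_def)
next
  case (TBin b t t')
  then show ?case using K by (auto simp: transport_sel closed_subset_def Pi_iff)
qed (use sub_K assms(2) in \<open>auto simp: transport_sel transport_inv subgroup_def\<close>)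

lemma transport_satisfies:
  assumes "wf_trm V l" "wf_trm V r"
  shows "satisfies (transport h K G) l r \<longleftrightarrow>
    (\<forall>w. (\<forall>n. w n \<in> K) \<longrightarrow> eval G w l = eval G w r)" (is "_ \<longleftrightarrow> ?R")
proof
  assume L: "satisfies (transport h K G) l r"
  show ?R
  proof (intro allI impI)
    fix w :: "nat \<Rightarrow> 'a" assume w: "\<forall>n. w n \<in> K"
    then have "(\<lambda>n. h (w n)) \<in> UNIV \<rightarrow> carrier (transport h K G)"
      by (auto simp: transport_sel)
    with L have "eval (transport h K G) (\<lambda>n. h (w n)) l = eval (transport h K G) (\<lambda>n. h (w n)) r"
      by (simp add: satisfies_def)
    then show "eval G w l = eval G w r"
      using transport_eval[of l w] transport_eval[of r w] assms w h by (auto simp: inj_on_eq_iff)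
  qed
next
  assume R: ?R
  show "satisfies (transport h K G) l r"
    unfolding satisfies_def
  proof
    fix v :: "nat \<Rightarrow> 'c" assume v: "v \<in> UNIV \<rightarrow> carrier (transport h K G)"
    define w where "w n = inv_into K h (v n)" for n
    have vn: "v n \<in> h ` K" for n using v by (auto simp: transport_sel)
    have w: "w n \<in> K" for n using inv_into_into[OF vn] by (simp add: w_def)
    have "v = (\<lambda>n. h (w n))" using f_inv_into_f[OF vn] by (auto simp: w_def)
    then show "eval (transport h K G) v l = eval (transport h K G) v r"
      using transport_eval[of l w] transport_eval[of r w] assms w R by auto
  qed
qed

lemma transport_object:
  assumes "wf_variety V"
  shows "object V (transport h K G)"
proof -
  have "K \<subseteq> carrier G" using sub_K by (rule subgroup.subset)
  then have "satisfies (transport h K G) l r" if "(l, r) \<in> identities V" for l r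
    using G that assms
    by (subst transport_satisfies) (force simp: object_def wf_variety_def satisfies_def)+
  then show ?thesis
    using K transport_group
    by (auto simp: object_def transport_sel closed_subset_def Pi_iff)
qed

end

theorem valid_satisfies:
  fixes C :: "('a, 'u, 'b) alg"
  assumes V: "wf_variety V" and val: "valid V l r" and wf: "wf_trm V l" "wf_trm V r"
    and C: "object V C"
  shows "satisfies C l r"
  unfolding satisfies_def
proof
  fix v :: "nat \<Rightarrow> 'a" assume v: "v \<in> UNIV \<rightarrow> carrier C"
  interpret group C using C by (simp add: object_def)
  define K where "K = eval C v ` {t. wf_trm V t}"
  have in_C: "eval C v t \<in> carrier C" if "wf_trm V t" for t
    using that by (induction t) (use C v in \<open>auto simp: object_def Pi_iff\<close>)
  have KI: "eval C v t \<in> K" if "wf_trm V t" for t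
    using that by (auto simp: K_def)
  have K: "closed_subset V K C"
    unfolding closed_subset_def
  proof (intro conjI ballI subgroupI)
    show "K \<subseteq> carrier C" using in_C by (auto simp: K_def)
    show "K \<noteq> {}" using KI[of TZero] by auto
    show "inv\<^bsub>C\<^esub> a \<in> K" if a: "a \<in> K" for a
    proof -
      obtain t where "wf_trm V t" "a = eval C v t" using a by (auto simp: K_def)
      then show ?thesis using KI[of "TNeg t"] by simp
    qed
    show "a \<otimes>\<^bsub>C\<^esub> b \<in> K" if ab: "a \<in> K" "b \<in> K" for a b
    proof -
      obtain t t' where "wf_trm V t" "a = eval C v t" "wf_trm V t'" "b = eval C v t'"
        using ab by (auto simp: K_def)
      then show ?thesis using KI[of "TPlus t t'"] by simp
    qed
    show "unop C u \<in> K \<rightarrow> K" if "u \<in> unary V" for u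
    proof
      fix a assume "a \<in> K"
      then obtain t where "wf_trm V t" "a = eval C v t" by (auto simp: K_def)
      then show "unop C u a \<in> K" using KI[of "TUn u t"] that by simp
    qed
    show "binop C c \<in> K \<rightarrow> K \<rightarrow> K" if "c \<in> binary V" for c
    proof (intro Pi_I)
      fix a b assume "a \<in> K" "b \<in> K"
      then obtain t t' where "wf_trm V t" "a = eval C v t" "wf_trm V t'" "b = eval C v t'"
        by (auto simp: K_def)
      then show "binop C c a b \<in> K" using KI[of "TBin c t t'"] that by simp
    qed
  qed
  define h where "h = inv_into {t. wf_trm V t} (eval C v)"
  have h: "inj_on h K" unfolding h_def K_def by (rule inj_on_inv_into) simp
  have "satisfies (transport h K C) l r"
    using val transport_object[OF C K h V] by (simp add: valid_def)
  then show "eval C v l = eval C v r"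
    using transport_satisfies[OF C K h wf] KI[of "TVar n" for n] by simp
qed

theorem derived_actionI:
  fixes E :: "('e, 'u, 'b) alg" and A :: "('x, 'u, 'b) alg" and B :: "('y, 'u, 'b) alg"
  assumes V: "wf_variety V" and ext: "split_extension V A E B i p s"
    and act: "induces_action V A E B i s \<alpha>"
  shows "derived_action V B A \<alpha>"
proof -
  have obj: "object V A" "object V E" "object V B" and i: "i \<in> mor V A E"
    and p: "p \<in> mor V E B" and s: "s \<in> mor V B E" and surj: "p ` carrier E = carrier B"
    and inj: "inj_on i (carrier A)" and ker: "i ` carrier A = kernel E B p"
    and ps: "\<And>b. b \<in> carrier B \<Longrightarrow> p (s b) = b"
    using ext by (auto simp: split_extension_def)
  interpret E: group E using obj by (simp add: object_def)
  interpret B: group B using obj by (simp add: object_def)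
  interpret p: group_hom E B p
    using p by unfold_locales (simp add: mor_def)
  have iE: "i x \<in> carrier E" if "x \<in> carrier A" for x
    using i that by (auto simp: mor_def hom_def)
  have sE: "s x \<in> carrier E" if "x \<in> carrier B" for x
    using s that by (auto simp: mor_def hom_def)
  define h where "h e = (inv_into (carrier A) i (e \<otimes>\<^bsub>E\<^esub> inv\<^bsub>E\<^esub> (s (p e))), p e)" for e
  have h: "inj_on h (carrier E)"
  proof (rule inj_onI)
    fix e e' assume e: "e \<in> carrier E" "e' \<in> carrier E" "h e = h e'"
    have k: "x \<otimes>\<^bsub>E\<^esub> inv\<^bsub>E\<^esub> (s (p x)) \<in> i ` carrier A" if "x \<in> carrier E" for x
      unfolding ker using that sE by (auto simp: kernel_def ps)
    have "e \<otimes>\<^bsub>E\<^esub> inv\<^bsub>E\<^esub> (s (p e)) = e' \<otimes>\<^bsub>E\<^esub> inv\<^bsub>E\<^esub> (s (p e))"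
      using f_inv_into_f[OF k[OF e(1)]] f_inv_into_f[OF k[OF e(2)]] e(3)
      by (metis h_def prod.inject)
    then show "e = e'" using e sE by simp
  qed
  have K: "closed_subset V (carrier E) E"
    using obj(2) E.subgroup_self by (auto simp: closed_subset_def object_def)
  let ?E = "transport h (carrier E) E"
  note sel = transport_sel[OF obj(2) K h] and hinv = transport_inv[OF obj(2) K h]
  have objE: "object V ?E" by (rule transport_object[OF obj(2) K h V])
  define q where "q x = p (inv_into (carrier E) h x)" for x
  have q: "q (h e) = p e" if "e \<in> carrier E" for e
    using h that by (simp add: q_def)
  have Eun: "unop E u x \<in> carrier E" if "u \<in> unary V" "x \<in> carrier E" for u x
    using obj(2) that by (auto simp: object_def)
  have Ebin: "binop E c x y \<in> carrier E" if "c \<in> binary V" "x \<in> carrier E" "y \<in> carrier E" for c x y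
    using obj(2) that by (auto simp: object_def Pi_iff)
  have "split_extension V A ?E B (h \<circ> i) q (h \<circ> s)"
    unfolding split_extension_def
  proof (intro conjI ballI obj(1,3) objE)
    show "h \<circ> i \<in> mor V A ?E"
      using i iE by (auto simp: mor_def hom_def sel)
    show "h \<circ> s \<in> mor V B ?E"
      using s sE by (auto simp: mor_def hom_def sel)
    show "q \<in> mor V ?E B"
      using p by (auto simp: mor_def hom_def sel q Eun Ebin)
    show "q ` carrier ?E = carrier B"
      using surj q by (force simp: sel image_image)
    show "inj_on (h \<circ> i) (carrier A)"
      using inj h iE by (auto intro!: comp_inj_on inj_on_subset[OF h])
    have "kernel ?E B q = h ` kernel E B p"
      by (auto simp: kernel_def sel q)
    then show "(h \<circ> i) ` carrier A = kernel ?E B q"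
      by (simp only: image_comp[symmetric] ker)
  next
    fix b assume "b \<in> carrier B"
    then show "q ((h \<circ> s) b) = b" by (simp add: q sE ps)
  qed
  moreover have "induces_action V A ?E B (h \<circ> i) (h \<circ> s) \<alpha>"
    using act iE sE by (auto simp: induces_action_def sel hinv)
  ultimately show ?thesis
    unfolding derived_action_def by blast
qed

end

theory Submission
  imports Defs
begin

text \<open>
  Apart from the claim that the given action of \<open>S\<close> on \<open>A = P \<times>\<^sub>R S\<close> is derived, every part of
  the theorem is read off componentwise: XM1 is built into the action, XM2 is XM2 of \<open>\<partial>\<close> in the
  first component and the definition of conjugation in the second, and the mediating map is
  forced to be \<open>x \<mapsto> (f x, \<mu> x)\<close>, because \<open>\<phi>'\<close> and \<open>\<partial>\<^sup>\<star>\<close> are the two projections.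

  To see that the action is derived, a split extension of \<open>S\<close> by \<open>A\<close> has to be exhibited. No
  axioms for actions are checked; instead the extension is assembled from the one given for \<open>P\<close>.
  Let \<open>0 \<rightarrow> P \<rightarrow> E \<rightarrow> R \<rightarrow> 0\<close> be a split extension inducing the action of \<open>R\<close>, with injection \<open>i\<close>,
  projection \<open>q\<close> and section \<open>\<sigma>\<close>. Besides the source map \<open>q\<close> there is the target map
  \<open>\<tau> (i a + \<sigma> r) = \<partial> a + r\<close>, a morphism because of XM1 and distributivity (\<open>target_map\<close>). Read
  \<open>E\<close> as arrows \<open>e : q e \<rightarrow> \<tau> e\<close> over \<open>R\<close>; the induced arrows over \<open>S\<close> are the triples
  \<open>(e, s, t)\<close> with \<open>q e = \<phi> s\<close> and \<open>\<tau> e = \<phi> t\<close>. They form an iterated fiber product, hence an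
  object (\<open>fiber_product_object\<close>). The source map to \<open>S\<close> is split by
  the identity arrows \<open>t \<mapsto> (\<sigma> (\<phi> t), t, t)\<close>, its kernel consists of the triples \<open>(i a, 0, s)\<close>
  with \<open>\<partial> a = \<phi> s\<close>, which is a copy of \<open>A\<close>, and the action it induces is the given one
  (\<open>pullback_derived_action\<close>).
\<close>

section \<open>Morphisms\<close>

lemma objectD:
  assumes "object V G"
  shows "group G"
    and "u \<in> unary V \<Longrightarrow> x \<in> carrier G \<Longrightarrow> unop G u x \<in> carrier G"
    and "b \<in> binary V \<Longrightarrow> x \<in> carrier G \<Longrightarrow> y \<in> carrier G \<Longrightarrow> binop G b x y \<in> carrier G"
    and "(l, r) \<in> identities V \<Longrightarrow> satisfies G l r"
  using assms by (auto simp: object_def Pi_iff)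

lemma morD:
  assumes "f \<in> mor V G H"
  shows "x \<in> carrier G \<Longrightarrow> f x \<in> carrier H"
    and "x \<in> carrier G \<Longrightarrow> y \<in> carrier G \<Longrightarrow> f (x \<otimes>\<^bsub>G\<^esub> y) = f x \<otimes>\<^bsub>H\<^esub> f y"
    and "u \<in> unary V \<Longrightarrow> x \<in> carrier G \<Longrightarrow> f (unop G u x) = unop H u (f x)"
    and "b \<in> binary V \<Longrightarrow> x \<in> carrier G \<Longrightarrow> y \<in> carrier G \<Longrightarrow>
      f (binop G b x y) = binop H b (f x) (f y)"
  using assms by (auto simp: mor_def hom_def)

lemma mor_one:
  assumes "object V G" "object V H" "f \<in> mor V G H"
  shows "f \<one>\<^bsub>G\<^esub> = \<one>\<^bsub>H\<^esub>"
  using assms by (intro hom_one) (auto simp: mor_def object_def)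

lemma mor_inv:
  assumes "object V G" "object V H" "f \<in> mor V G H" "x \<in> carrier G"
  shows "f (inv\<^bsub>G\<^esub> x) = inv\<^bsub>H\<^esub> (f x)"
proof -
  interpret group_hom G H f
    using assms by (intro group_hom.intro group_hom_axioms.intro) (auto simp: mor_def object_def)
  show ?thesis using assms by simp
qed

lemma mor_comp:
  assumes "f \<in> mor V G H" "g \<in> mor V H K"
  shows "g \<circ> f \<in> mor V G K"
  using assms by (auto simp: mor_def hom_def Pi_iff)

lemma mor_id: "id \<in> mor V G G"
  by (auto simp: mor_def hom_def)

lemma mor_restrict:
  assumes "object V G" "f \<in> mor V G H"
  shows "restrict f (carrier G) \<in> mor V G H"
proof -
  interpret group G using assms(1) by (rule objectD)
  show ?thesis
    using assms by (auto simp: mor_def hom_def Pi_iff objectD)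
qed

lemma inv_cancel:
  assumes "group G" "x \<in> carrier G" "y \<in> carrier G"
  shows "inv\<^bsub>G\<^esub> x \<otimes>\<^bsub>G\<^esub> (x \<otimes>\<^bsub>G\<^esub> y) = y"
proof -
  interpret group G by fact
  show ?thesis using assms(2,3) by (simp flip: m_assoc)
qed

section \<open>Distributivity\<close>

lemma satisfies3:
  assumes "satisfies G l r" "x \<in> carrier G" "y \<in> carrier G" "z \<in> carrier G"
  shows "eval G (\<lambda>n. if n = 0 then x else if n = 1 then y else z) l =
    eval G (\<lambda>n. if n = 0 then x else if n = 1 then y else z) r"
  using assms unfolding satisfies_def by (auto simp: Pi_iff)

lemma binop_distrib_left:
  assumes "mci V" "object V G" "b \<in> binary V"
    and "x \<in> carrier G" "y \<in> carrier G" "z \<in> carrier G"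
  shows "binop G b x (y \<otimes>\<^bsub>G\<^esub> z) = binop G b x y \<otimes>\<^bsub>G\<^esub> binop G b x z"
proof -
  have "(TBin b tx (TPlus ty tz), TPlus (TBin b tx ty) (TBin b tx tz)) \<in> identities V"
    using assms(1,3) by (auto simp: mci_def)
  from satisfies3[OF objectD(4)[OF assms(2) this] assms(4-6)] show ?thesis by simp
qed

lemma unop_distrib:
  assumes "mci V" "object V G" "u \<in> unary V" "x \<in> carrier G" "y \<in> carrier G"
  shows "unop G u (x \<otimes>\<^bsub>G\<^esub> y) = unop G u x \<otimes>\<^bsub>G\<^esub> unop G u y"
proof -
  have "(TUn u (TPlus tx ty), TPlus (TUn u tx) (TUn u ty)) \<in> identities V"
    using assms(1,3) by (auto simp: mci_def)
  from satisfies3[OF objectD(4)[OF assms(2) this] assms(4,5,5)] show ?thesis by simp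
qed

text \<open>
  The opposite operation is named by the variety, so one \<open>b'\<close> serves both objects; comparing
  operations along a morphism from \<open>G\<close> to \<open>H\<close> depends on this.
\<close>

lemma opposite_binop:
  fixes G :: "('a, 'u, 'b) alg" and H :: "('c, 'u, 'b) alg"
  assumes "mci V" "b \<in> binary V" and G: "object V G" and H: "object V H"
  obtains b' where "b' \<in> binary V"
    and "\<And>x y. x \<in> carrier G \<Longrightarrow> y \<in> carrier G \<Longrightarrow> binop G b' x y = binop G b y x"
    and "\<And>x y. x \<in> carrier H \<Longrightarrow> y \<in> carrier H \<Longrightarrow> binop H b' x y = binop H b y x"
proof -
  obtain b' where b': "b' \<in> binary V" and val: "valid V (TBin b' tx ty) (TBin b ty tx)"
    using assms(1,2) by (auto simp: mci_def)
  have V: "wf_variety V" using assms(1) by (simp add: mci_def)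
  have wf: "wf_trm V (TBin b' tx ty)" "wf_trm V (TBin b ty tx)"
    using b' assms(2) by simp_all
  note sat = valid_satisfies[OF V val wf]
  show ?thesis
  proof (rule that[OF b'])
    show "binop G b' x y = binop G b y x" if "x \<in> carrier G" "y \<in> carrier G" for x y
      using satisfies3[OF sat[OF G] that(1,2,2)] by simp
    show "binop H b' x y = binop H b y x" if "x \<in> carrier H" "y \<in> carrier H" for x y
      using satisfies3[OF sat[OF H] that(1,2,2)] by simp
  qed
qed

lemma binop_distrib_right:
  assumes "mci V" "object V G" "b \<in> binary V"
    and "x \<in> carrier G" "y \<in> carrier G" "z \<in> carrier G"
  shows "binop G b (x \<otimes>\<^bsub>G\<^esub> y) z = binop G b x z \<otimes>\<^bsub>G\<^esub> binop G b y z"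
proof -
  interpret group G using assms(2) by (rule objectD)
  obtain b' where "b' \<in> binary V"
    and "\<And>x y. x \<in> carrier G \<Longrightarrow> y \<in> carrier G \<Longrightarrow> binop G b' x y = binop G b y x"
    by (rule opposite_binop[OF assms(1,3,2,2)]) blast
  with binop_distrib_left[OF assms(1,2), of b' z x y] assms(4-6) show ?thesis by simp
qed

lemma binop_distrib:
  assumes "mci V" "object V G" "b \<in> binary V"
    and "w \<in> carrier G" "x \<in> carrier G" "y \<in> carrier G" "z \<in> carrier G"
  shows "binop G b (w \<otimes>\<^bsub>G\<^esub> x) (y \<otimes>\<^bsub>G\<^esub> z) =
    binop G b w y \<otimes>\<^bsub>G\<^esub> binop G b x y \<otimes>\<^bsub>G\<^esub> binop G b w z \<otimes>\<^bsub>G\<^esub> binop G b x z"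
proof -
  interpret group G using assms(2) by (rule objectD)
  show ?thesis
    using assms
    by (simp add: binop_distrib_left[OF assms(1-3)] binop_distrib_right[OF assms(1-3)]
        objectD[OF assms(2)] m_assoc)
qed

lemma binop_one_right:
  assumes "mci V" "object V G" "b \<in> binary V" "x \<in> carrier G"
  shows "binop G b x \<one>\<^bsub>G\<^esub> = \<one>\<^bsub>G\<^esub>"
proof -
  interpret group G using assms(2) by (rule objectD)
  have "binop G b x \<one>\<^bsub>G\<^esub> \<otimes>\<^bsub>G\<^esub> binop G b x \<one>\<^bsub>G\<^esub> = binop G b x \<one>\<^bsub>G\<^esub>"
    using binop_distrib_left[OF assms, of "\<one>\<^bsub>G\<^esub>" "\<one>\<^bsub>G\<^esub>"] by simp
  then show ?thesis
    using objectD(3)[OF assms(2,3,4), of "\<one>\<^bsub>G\<^esub>"] by (simp add: r_cancel_one')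
qed

lemma unop_one:
  assumes "mci V" "object V G" "u \<in> unary V"
  shows "unop G u \<one>\<^bsub>G\<^esub> = \<one>\<^bsub>G\<^esub>"
proof -
  interpret group G using assms(2) by (rule objectD)
  have "unop G u \<one>\<^bsub>G\<^esub> \<otimes>\<^bsub>G\<^esub> unop G u \<one>\<^bsub>G\<^esub> = unop G u \<one>\<^bsub>G\<^esub>"
    using unop_distrib[OF assms, of "\<one>\<^bsub>G\<^esub>" "\<one>\<^bsub>G\<^esub>"] by simp
  then show ?thesis
    using objectD(2)[OF assms(2,3), of "\<one>\<^bsub>G\<^esub>"] by (simp add: r_cancel_one')
qed

text \<open>
  The zero map is a morphism only because \<open>0 \<star> 0 = 0\<close> and \<open>\<omega> 0 = 0\<close>, which the additivity
  identities force.
\<close>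

lemma mor_const_one:
  assumes "mci V" "object V H"
  shows "(\<lambda>_. \<one>\<^bsub>H\<^esub>) \<in> mor V G H"
proof -
  interpret group H using assms(2) by (rule objectD)
  show ?thesis
    using assms by (auto simp: mor_def hom_def binop_one_right unop_one)
qed

section \<open>Fiber products\<close>

lemma fiber_product_sel:
  "carrier (fiber_product P S f g) = {(p, s). p \<in> carrier P \<and> s \<in> carrier S \<and> f p = g s}"
  "x \<otimes>\<^bsub>fiber_product P S f g\<^esub> y = (fst x \<otimes>\<^bsub>P\<^esub> fst y, snd x \<otimes>\<^bsub>S\<^esub> snd y)"
  "\<one>\<^bsub>fiber_product P S f g\<^esub> = (\<one>\<^bsub>P\<^esub>, \<one>\<^bsub>S\<^esub>)"
  "unop (fiber_product P S f g) u x = (unop P u (fst x), unop S u (snd x))"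
  "binop (fiber_product P S f g) b x y = (binop P b (fst x) (fst y), binop S b (snd x) (snd y))"
  by (auto simp: fiber_product_def split: prod.splits)

lemma fst_mor: "fst \<in> mor V (fiber_product P S f g) P"
  and snd_mor: "snd \<in> mor V (fiber_product P S f g) S"
  by (auto simp: mor_def hom_def fiber_product_sel)

lemma mor_pair:
  assumes "h \<in> mor V X P" "k \<in> mor V X S" "\<And>x. x \<in> carrier X \<Longrightarrow> f (h x) = g (k x)"
  shows "(\<lambda>x. (h x, k x)) \<in> mor V X (fiber_product P S f g)"
  using assms by (auto simp: mor_def hom_def fiber_product_sel)

context
  fixes V :: "('u, 'b) variety"
    and P :: "('p, 'u, 'b) alg" and R :: "('r, 'u, 'b) alg" and S :: "('s, 'u, 'b) alg"
    and f g
  assumes P: "object V P" and R: "object V R" and S: "object V S"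
    and f: "f \<in> mor V P R" and g: "g \<in> mor V S R"
begin

lemma fiber_product_group: "group (fiber_product P S f g)"
proof -
  interpret P: group P using P by (rule objectD)
  interpret S: group S using S by (rule objectD)
  show ?thesis
  proof (rule groupI)
    fix x assume x: "x \<in> carrier (fiber_product P S f g)"
    show "\<exists>y\<in>carrier (fiber_product P S f g).
        y \<otimes>\<^bsub>fiber_product P S f g\<^esub> x = \<one>\<^bsub>fiber_product P S f g\<^esub>"
      using x
      by (intro bexI[of _ "(inv\<^bsub>P\<^esub> (fst x), inv\<^bsub>S\<^esub> (snd x))"])
        (auto simp: fiber_product_sel mor_inv[OF P R f] mor_inv[OF S R g])
  qed (auto simp: fiber_product_sel P.m_assoc S.m_assoc morD[OF f] morD[OF g]
      mor_one[OF P R f] mor_one[OF S R g])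
qed

lemma fiber_product_inv:
  assumes "x \<in> carrier (fiber_product P S f g)"
  shows "inv\<^bsub>fiber_product P S f g\<^esub> x = (inv\<^bsub>P\<^esub> (fst x), inv\<^bsub>S\<^esub> (snd x))"
proof -
  interpret P: group P using P by (rule objectD)
  interpret S: group S using S by (rule objectD)
  show ?thesis
    using assms
    by (intro group.inv_equality[OF fiber_product_group])
      (auto simp: fiber_product_sel mor_inv[OF P R f] mor_inv[OF S R g])
qed

lemma fiber_product_ops_closed:
  "u \<in> unary V \<Longrightarrow> x \<in> carrier (fiber_product P S f g) \<Longrightarrow>
    unop (fiber_product P S f g) u x \<in> carrier (fiber_product P S f g)"
  "b \<in> binary V \<Longrightarrow> x \<in> carrier (fiber_product P S f g) \<Longrightarrow>
    y \<in> carrier (fiber_product P S f g) \<Longrightarrow>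
    binop (fiber_product P S f g) b x y \<in> carrier (fiber_product P S f g)"
  by (auto simp: fiber_product_sel objectD[OF P] objectD[OF S] morD[OF f] morD[OF g])

text \<open>
  Membership is carried along in the induction because \<open>inv\<close> in the fiber product is
  componentwise only on the carrier.
\<close>

lemma fiber_product_eval:
  assumes "wf_trm V t" "\<And>n. v n \<in> carrier (fiber_product P S f g)"
  shows "eval (fiber_product P S f g) v t \<in> carrier (fiber_product P S f g) \<and>
    eval (fiber_product P S f g) v t = (eval P (fst \<circ> v) t, eval S (snd \<circ> v) t)"
  using assms(1)
proof (induction t)
  case (TUn u t)
  then have "unop (fiber_product P S f g) u (eval (fiber_product P S f g) v t)
      \<in> carrier (fiber_product P S f g)"
    by (intro fiber_product_ops_closed) auto
  with TUn show ?case by (simp add: fiber_product_sel(4))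
next
  case (TBin b t t')
  then have "binop (fiber_product P S f g) b
      (eval (fiber_product P S f g) v t) (eval (fiber_product P S f g) v t')
      \<in> carrier (fiber_product P S f g)"
    by (intro fiber_product_ops_closed) auto
  with TBin show ?case by (simp add: fiber_product_sel(5))
next
  case (TPlus t t')
  then have "eval (fiber_product P S f g) v t \<otimes>\<^bsub>fiber_product P S f g\<^esub>
      eval (fiber_product P S f g) v t' \<in> carrier (fiber_product P S f g)"
    by (intro monoid.m_closed[OF group.is_monoid[OF fiber_product_group]]) auto
  with TPlus show ?case by (simp add: fiber_product_sel(2))
next
  case (TNeg t)
  then have "eval (fiber_product P S f g) v t \<in> carrier (fiber_product P S f g)"
    by (metis wf_trm.simps(3))
  from group.inv_closed[OF fiber_product_group this] fiber_product_inv[OF this] TNeg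
  show ?case by simp
next
  case TZero
  show ?case
    using group.is_monoid[OF fiber_product_group, THEN monoid.one_closed]
    by (simp add: fiber_product_sel(3))
next
  case (TVar n)
  show ?case using assms(2) by simp
qed

lemma fiber_product_object:
  assumes V: "wf_variety V"
  shows "object V (fiber_product P S f g)"
  unfolding object_def
proof (intro conjI ballI)
  show "group (fiber_product P S f g)" by (rule fiber_product_group)
  have "satisfies (fiber_product P S f g) l r" if lr: "(l, r) \<in> identities V" for l r
    unfolding satisfies_def
  proof
    fix v :: "nat \<Rightarrow> _" assume "v \<in> UNIV \<rightarrow> carrier (fiber_product P S f g)"
    then have v: "v n \<in> carrier (fiber_product P S f g)" for n by blast
    then have "fst \<circ> v \<in> UNIV \<rightarrow> carrier P" "snd \<circ> v \<in> UNIV \<rightarrow> carrier S"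
      using morD(1)[OF fst_mor v] morD(1)[OF snd_mor v] by auto
    then have "eval P (fst \<circ> v) l = eval P (fst \<circ> v) r" "eval S (snd \<circ> v) l = eval S (snd \<circ> v) r"
      using objectD(4)[OF P lr] objectD(4)[OF S lr] by (simp_all add: satisfies_def)
    moreover have "wf_trm V l" "wf_trm V r" using V lr by (auto simp: wf_variety_def)
    ultimately show "eval (fiber_product P S f g) v l = eval (fiber_product P S f g) v r"
      using fiber_product_eval v by metis
  qed
  then show "\<And>lr. lr \<in> identities V \<Longrightarrow> case lr of (l, r) \<Rightarrow> satisfies (fiber_product P S f g) l r"
    by blast
qed (auto intro!: fiber_product_ops_closed)

end

section \<open>The target map of a crossed module\<close>

text \<open>
  In the semidirect product attached to a crossed module, \<open>(a, r) \<mapsto> \<partial> a + r\<close> is a second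
  retraction onto the base besides the projection. Additivity is the first half of XM1.
  Multiplicativity compares the four-term expansion of \<open>(i a + s r) \<star> (i a' + s r')\<close> with that
  of \<open>(\<partial> a + r) \<star> (\<partial> a' + r')\<close>; the second half of XM1 covers \<open>s r \<star> i a'\<close> directly and
  \<open>i a \<star> s r'\<close> through the opposite operation.
\<close>

lemma target_map:
  fixes P :: "('p, 'u, 'b) alg" and E :: "('e, 'u, 'b) alg" and R :: "('r, 'u, 'b) alg"
  assumes V: "mci V"
    and ext: "split_extension V P E R i q s" and act: "induces_action V P E R i s \<beta>"
    and d: "d \<in> mor V P R"
    and XM1_dot: "\<And>r a. r \<in> carrier R \<Longrightarrow> a \<in> carrier P \<Longrightarrow>
      d (act_dot \<beta> r a) = r \<otimes>\<^bsub>R\<^esub> d a \<otimes>\<^bsub>R\<^esub> inv\<^bsub>R\<^esub> r"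
    and XM1_star: "\<And>r a b. r \<in> carrier R \<Longrightarrow> a \<in> carrier P \<Longrightarrow> b \<in> binary V \<Longrightarrow>
      d (act_star \<beta> b r a) = binop R b r (d a)"
  obtains \<tau> where "\<tau> \<in> mor V E R"
    and "\<And>a. a \<in> carrier P \<Longrightarrow> \<tau> (i a) = d a"
    and "\<And>r. r \<in> carrier R \<Longrightarrow> \<tau> (s r) = r"
proof -
  have objs: "object V P" "object V E" "object V R"
    and i: "i \<in> mor V P E" and q: "q \<in> mor V E R" and s: "s \<in> mor V R E"
    and inj: "inj_on i (carrier P)" and ker: "i ` carrier P = kernel E R q"
    and qs: "\<And>r. r \<in> carrier R \<Longrightarrow> q (s r) = r"
    using ext by (auto simp: split_extension_def)
  interpret P: group P using objs(1) by (rule objectD)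
  interpret E: group E using objs(2) by (rule objectD)
  interpret R: group R using objs(3) by (rule objectD)
  note [simp] = morD(1)[OF i] morD(1)[OF q] morD(1)[OF s] morD(1)[OF d]
    objectD(2,3)[OF objs(1)] objectD(2,3)[OF objs(2)] objectD(2,3)[OF objs(3)]
  have qi: "q (i a) = \<one>\<^bsub>R\<^esub>" if "a \<in> carrier P" for a
    using that ker by (auto simp: kernel_def)
  \<comment> \<open>The \<open>i\<close>-component of \<open>e = i a + s r\<close> is recovered as \<open>e - s (q e)\<close>, since \<open>q e = r\<close>.\<close>
  define \<tau> where "\<tau> e = d (inv_into (carrier P) i (e \<otimes>\<^bsub>E\<^esub> inv\<^bsub>E\<^esub> s (q e))) \<otimes>\<^bsub>R\<^esub> q e" for e
  have \<tau>: "\<tau> (i a \<otimes>\<^bsub>E\<^esub> s r) = d a \<otimes>\<^bsub>R\<^esub> r" if "a \<in> carrier P" "r \<in> carrier R" for a r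
    using that by (simp add: \<tau>_def morD(2)[OF q] qi qs E.m_assoc inv_into_f_f[OF inj])
  have decomp: "\<exists>a\<in>carrier P. \<exists>r\<in>carrier R. e = i a \<otimes>\<^bsub>E\<^esub> s r" if e: "e \<in> carrier E" for e
  proof -
    have "e \<otimes>\<^bsub>E\<^esub> inv\<^bsub>E\<^esub> s (q e) \<in> i ` carrier P"
      unfolding ker using e
      by (simp add: kernel_def morD(2)[OF q] mor_inv[OF objs(2,3) q] qs)
    then obtain a where a: "a \<in> carrier P" "e \<otimes>\<^bsub>E\<^esub> inv\<^bsub>E\<^esub> s (q e) = i a" by auto
    have "e = i a \<otimes>\<^bsub>E\<^esub> s (q e)" using e by (simp add: a(2)[symmetric] E.m_assoc)
    with a(1) morD(1)[OF q e] show ?thesis by blast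
  qed
  have dotP: "act_dot \<beta> r a \<in> carrier P"
    and dotE: "i (act_dot \<beta> r a) = s r \<otimes>\<^bsub>E\<^esub> i a \<otimes>\<^bsub>E\<^esub> inv\<^bsub>E\<^esub> s r"
    if "r \<in> carrier R" "a \<in> carrier P" for r a
    using act that by (auto simp: induces_action_def)
  have starP: "act_star \<beta> b r a \<in> carrier P"
    and starE: "i (act_star \<beta> b r a) = binop E b (s r) (i a)"
    if "r \<in> carrier R" "a \<in> carrier P" "b \<in> binary V" for r a b
    using act that by (auto simp: induces_action_def)
  have "\<tau> \<in> mor V E R"
    unfolding mor_def hom_def
  proof (intro CollectI conjI ballI Pi_I)
    fix e assume "e \<in> carrier E"
    then obtain a r where "e = i a \<otimes>\<^bsub>E\<^esub> s r" "a \<in> carrier P" "r \<in> carrier R"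
      using decomp by meson
    then show "\<tau> e \<in> carrier R" by (simp add: \<tau>)
  next
    fix e e' assume "e \<in> carrier E" "e' \<in> carrier E"
    then obtain a r a' r' where e: "e = i a \<otimes>\<^bsub>E\<^esub> s r" "e' = i a' \<otimes>\<^bsub>E\<^esub> s r'"
      and [simp]: "a \<in> carrier P" "r \<in> carrier R" "a' \<in> carrier P" "r' \<in> carrier R"
      using decomp by meson
    \<comment> \<open>moving \<open>s r\<close> past \<open>i a'\<close> conjugates \<open>a'\<close> by \<open>r\<close>\<close>
    have "e \<otimes>\<^bsub>E\<^esub> e' = i (a \<otimes>\<^bsub>P\<^esub> act_dot \<beta> r a') \<otimes>\<^bsub>E\<^esub> s (r \<otimes>\<^bsub>R\<^esub> r')"
      by (simp add: e morD(2)[OF i] morD(2)[OF s] dotP dotE E.m_assoc inv_cancel[OF E.group_axioms])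
    then show "\<tau> (e \<otimes>\<^bsub>E\<^esub> e') = \<tau> e \<otimes>\<^bsub>R\<^esub> \<tau> e'"
      by (simp add: e \<tau> dotP morD(2)[OF d] XM1_dot R.m_assoc inv_cancel[OF R.group_axioms])
  next
    fix u e assume u: "u \<in> unary V" and "e \<in> carrier E"
    then obtain a r where e: "e = i a \<otimes>\<^bsub>E\<^esub> s r"
      and [simp]: "a \<in> carrier P" "r \<in> carrier R"
      using decomp by meson
    have "unop E u e = i (unop P u a) \<otimes>\<^bsub>E\<^esub> s (unop R u r)"
      using u by (simp add: e unop_distrib[OF V objs(2)] morD(3)[OF i] morD(3)[OF s])
    then show "\<tau> (unop E u e) = unop R u (\<tau> e)"
      using u by (simp add: e \<tau> unop_distrib[OF V objs(3)] morD(3)[OF d])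
  next
    fix b e e' assume b: "b \<in> binary V" and "e \<in> carrier E" "e' \<in> carrier E"
    then obtain a r a' r' where e: "e = i a \<otimes>\<^bsub>E\<^esub> s r" "e' = i a' \<otimes>\<^bsub>E\<^esub> s r'"
      and [simp]: "a \<in> carrier P" "r \<in> carrier R" "a' \<in> carrier P" "r' \<in> carrier R"
      using decomp by meson
    obtain b' where b': "b' \<in> binary V"
      and oppE: "\<And>x y. x \<in> carrier E \<Longrightarrow> y \<in> carrier E \<Longrightarrow> binop E b' x y = binop E b y x"
      and oppR: "\<And>x y. x \<in> carrier R \<Longrightarrow> y \<in> carrier R \<Longrightarrow> binop R b' x y = binop R b y x"
      by (rule opposite_binop[OF V b objs(2,3)]) blast
    have "binop E b e e' =
        i (binop P b a a' \<otimes>\<^bsub>P\<^esub> act_star \<beta> b r a' \<otimes>\<^bsub>P\<^esub> act_star \<beta> b' r' a) \<otimes>\<^bsub>E\<^esub> s (binop R b r r')"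
      using b b'
      by (simp add: e binop_distrib[OF V objs(2)] morD(2,4)[OF i] morD(4)[OF s] starP starE oppE)
    then show "\<tau> (binop E b e e') = binop R b (\<tau> e) (\<tau> e')"
      using b b'
      by (simp add: e \<tau> binop_distrib[OF V objs(3)] morD(2,4)[OF d] starP XM1_star oppR)
  qed
  moreover have "\<tau> (i a) = d a" if "a \<in> carrier P" for a
    using \<tau>[OF that, of "\<one>\<^bsub>R\<^esub>"] that by (simp add: mor_one[OF objs(3,2) s])
  moreover have "\<tau> (s r) = r" if "r \<in> carrier R" for r
    using \<tau>[of "\<one>\<^bsub>P\<^esub>" r] that by (simp add: mor_one[OF objs(1,2) i] mor_one[OF objs(1,3) d])
  ultimately show ?thesis by (rule that)
qed

section \<open>The pullback crossed module\<close>

lemma derived_action_closed: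
  assumes "derived_action V B A \<alpha>" "y \<in> carrier B" "x \<in> carrier A"
  shows "act_dot \<alpha> y x \<in> carrier A" and "b \<in> binary V \<Longrightarrow> act_star \<alpha> b y x \<in> carrier A"
  using assms by (auto simp: derived_action_def induces_action_def)

text \<open>
  The middle object is built from triples \<open>((e, s), t)\<close> in two fiber products, so that its being
  an object and the maps into it being morphisms need no computation. It embeds in the product
  of \<open>E\<close> with \<open>S \<times> S\<close>, and there the action becomes visible: conjugating \<open>((i a, 0), s)\<close> by
  \<open>((\<sigma> (\<phi> t), t), t)\<close> acts on \<open>a\<close> by \<open>\<phi> t\<close>, fixes \<open>0\<close> and conjugates \<open>s\<close> by \<open>t\<close>. For \<open>\<star>\<close> the
  middle entry stays \<open>0\<close> because \<open>t \<star> 0 = 0\<close>.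
\<close>

lemma pullback_derived_action:
  fixes V :: "('u, 'b) variety"
    and P :: "('p, 'u, 'b) alg" and R :: "('r, 'u, 'b) alg" and S :: "('s, 'u, 'b) alg"
  assumes V: "mci V" and X: "crossed_module V (P, R, d, \<beta>)"
    and S: "object V S" and \<phi>: "\<phi> \<in> mor V S R"
  shows "derived_action V S (fiber_product P S d \<phi>) (pullback_action S \<beta> \<phi>)"
proof -
  have P: "object V P" and R: "object V R" and d: "d \<in> mor V P R"
    and der: "derived_action V R P \<beta>"
    and XM1: "\<And>r a. r \<in> carrier R \<Longrightarrow> a \<in> carrier P \<Longrightarrow>
        d (act_dot \<beta> r a) = r \<otimes>\<^bsub>R\<^esub> d a \<otimes>\<^bsub>R\<^esub> inv\<^bsub>R\<^esub> r"
      "\<And>r a b. r \<in> carrier R \<Longrightarrow> a \<in> carrier P \<Longrightarrow> b \<in> binary V \<Longrightarrow>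
        d (act_star \<beta> b r a) = binop R b r (d a)"
    using X by auto
  have wf: "wf_variety V" using V by (simp add: mci_def)
  obtain E :: "('p \<times> 'r, 'u, 'b) alg" and i q \<sigma>
    where ext: "split_extension V P E R i q \<sigma>" and act: "induces_action V P E R i \<sigma> \<beta>"
    using der by (auto simp: derived_action_def)
  obtain \<tau> where \<tau>: "\<tau> \<in> mor V E R"
    and \<tau>i: "\<And>a. a \<in> carrier P \<Longrightarrow> \<tau> (i a) = d a"
    and \<tau>\<sigma>: "\<And>r. r \<in> carrier R \<Longrightarrow> \<tau> (\<sigma> r) = r"
    by (rule target_map[OF V ext act d]) (rule XM1 that; assumption)+
  have E: "object V E"
    and i: "i \<in> mor V P E" and q: "q \<in> mor V E R" and \<sigma>: "\<sigma> \<in> mor V R E"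
    and inj: "inj_on i (carrier P)" and ker: "i ` carrier P = kernel E R q"
    and q\<sigma>: "\<And>r. r \<in> carrier R \<Longrightarrow> q (\<sigma> r) = r"
    using ext by (auto simp: split_extension_def)
  interpret S: group S using S by (rule objectD)
  interpret E: group E using E by (rule objectD)
  define A where "A = fiber_product P S d \<phi>"
  define F where "F = fiber_product E S q \<phi>"
  define G where "G = fiber_product F S (\<tau> \<circ> fst) \<phi>"
  define j where "j = (\<lambda>x :: 'p \<times> 's. ((i (fst x), \<one>\<^bsub>S\<^esub>), snd x))"
  define p where "p = (snd \<circ> fst :: (('p \<times> 'r) \<times> 's) \<times> 's \<Rightarrow> 's)"
  define k where "k = (\<lambda>t :: 's. ((\<sigma> (\<phi> t), t), t))"
  note [simp] = morD(1)[OF i] morD(1)[OF \<sigma>] morD(1)[OF \<phi>]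
  have qi: "q (i a) = \<one>\<^bsub>R\<^esub>" if "a \<in> carrier P" for a
    using that ker by (auto simp: kernel_def)
  have \<phi>1: "\<phi> \<one>\<^bsub>S\<^esub> = \<one>\<^bsub>R\<^esub>" by (rule mor_one[OF S R \<phi>])
  have A: "object V A" unfolding A_def by (rule fiber_product_object[OF P R S d \<phi> wf])
  have F: "object V F" unfolding F_def by (rule fiber_product_object[OF E R S q \<phi> wf])
  have \<tau>F: "\<tau> \<circ> fst \<in> mor V F R" unfolding F_def by (rule mor_comp[OF fst_mor \<tau>])
  have G: "object V G" unfolding G_def by (rule fiber_product_object[OF F R S \<tau>F \<phi> wf])
  have i_fst: "(\<lambda>x. i (fst x)) \<in> mor V A E"
    using mor_comp[OF fst_mor i] by (simp add: A_def comp_def)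
  have i_one: "(\<lambda>x. (i (fst x), \<one>\<^bsub>S\<^esub>)) \<in> mor V A F"
    unfolding F_def
    by (rule mor_pair[OF i_fst mor_const_one[OF V S]])
      (auto simp: A_def fiber_product_sel qi \<phi>1)
  have snd_A: "snd \<in> mor V A S" unfolding A_def by (rule snd_mor)
  have j: "j \<in> mor V A G"
    unfolding G_def j_def
    by (rule mor_pair[OF i_one snd_A])
      (auto simp: A_def fiber_product_sel \<tau>i)
  have "(\<lambda>t. (\<sigma> (\<phi> t), t)) \<in> mor V S F"
    unfolding F_def
    by (rule mor_pair[OF mor_comp[OF \<phi> \<sigma>, unfolded comp_def] mor_id[unfolded id_def]]) (simp add: q\<sigma>)
  then have k: "k \<in> mor V S G"
    unfolding G_def k_def
    by (rule mor_pair[OF _ mor_id[unfolded id_def]]) (simp add: \<tau>\<sigma>)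
  have p: "p \<in> mor V G S"
    unfolding p_def G_def F_def by (rule mor_comp[OF fst_mor snd_mor])
  have pk: "p (k t) = t" for t by (simp add: p_def k_def)
  have kG: "k t \<in> carrier G" if "t \<in> carrier S" for t using morD(1)[OF k that] .
  have "split_extension V A G S j p k"
    unfolding split_extension_def
  proof (intro conjI ballI A G S j p k pk)
    show "p ` carrier G = carrier S"
    proof (intro subset_antisym subsetI)
      show "x \<in> carrier S" if "x \<in> p ` carrier G" for x using that morD(1)[OF p] by auto
      show "t \<in> p ` carrier G" if "t \<in> carrier S" for t
        using pk kG[OF that] by (rule image_eqI[OF sym])
    qed
    show "inj_on j (carrier A)"
      using inj by (auto simp: j_def A_def fiber_product_sel inj_on_def)
    show "j ` carrier A = kernel G S p"
    proof
      show "j ` carrier A \<subseteq> kernel G S p"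
        using morD(1)[OF j] by (auto simp: kernel_def p_def j_def)
      show "kernel G S p \<subseteq> j ` carrier A"
      proof
        fix x assume x: "x \<in> kernel G S p"
        then obtain e t where xe: "x = ((e, \<one>\<^bsub>S\<^esub>), t)" and e: "e \<in> carrier E" "q e = \<phi> \<one>\<^bsub>S\<^esub>"
          and t: "t \<in> carrier S" "\<tau> e = \<phi> t"
          by (auto simp: kernel_def p_def G_def F_def fiber_product_sel)
        then have "e \<in> i ` carrier P" unfolding ker by (simp add: kernel_def \<phi>1)
        then obtain a where "a \<in> carrier P" "e = i a" by auto
        with xe t show "x \<in> j ` carrier A"
          by (intro image_eqI[of _ _ "(a, t)"]) (auto simp: j_def A_def fiber_product_sel \<tau>i)
      qed
    qed
  qed
  moreover have "induces_action V A G S j k (pullback_action S \<beta> \<phi>)"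
    unfolding induces_action_def
  proof (intro ballI)
    fix t x assume t: "t \<in> carrier S" and "x \<in> carrier A"
    then obtain a s where x: "x = (a, s)" and a: "a \<in> carrier P" and s: "s \<in> carrier S"
      and das: "d a = \<phi> s"
      by (auto simp: A_def fiber_product_sel)
    have kF: "(\<sigma> (\<phi> t), t) \<in> carrier F"
      using t by (simp add: F_def fiber_product_sel q\<sigma>)
    have inv: "inv\<^bsub>G\<^esub> (k t) = ((inv\<^bsub>E\<^esub> \<sigma> (\<phi> t), inv\<^bsub>S\<^esub> t), inv\<^bsub>S\<^esub> t)"
      using fiber_product_inv[OF F R S \<tau>F \<phi>, folded G_def, OF kG[OF t]]
        fiber_product_inv[OF E R S q \<phi>, folded F_def, OF kF]
      by (simp add: k_def)
    show "act_dot (pullback_action S \<beta> \<phi>) t x \<in> carrier A \<and>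
        j (act_dot (pullback_action S \<beta> \<phi>) t x) = k t \<otimes>\<^bsub>G\<^esub> j x \<otimes>\<^bsub>G\<^esub> inv\<^bsub>G\<^esub> k t \<and>
        (\<forall>c\<in>binary V. act_star (pullback_action S \<beta> \<phi>) c t x \<in> carrier A \<and>
           j (act_star (pullback_action S \<beta> \<phi>) c t x) = binop G c (k t) (j x))"
      using t a s das act derived_action_closed[OF der, of "\<phi> t" a]
      unfolding inv
      by (simp add: x pullback_action_def A_def G_def F_def fiber_product_sel j_def k_def XM1
          induces_action_def morD(2,4)[OF \<phi>] mor_inv[OF S R \<phi>] objectD(3)[OF S]
          binop_one_right[OF V S])
  qed
  ultimately show ?thesis
    unfolding A_def[symmetric] by (rule derived_actionI[OF wf])
qed

lemma pullback_crossed_module: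
  assumes V: "mci V" and X: "crossed_module V (P, R, d, \<beta>)"
    and S: "object V S" and \<phi>: "\<phi> \<in> mor V S R"
  shows "crossed_module V (pullback_xmod (P, R, d, \<beta>) S \<phi>)"
proof -
  have P: "object V P" and R: "object V R" and d: "d \<in> mor V P R"
    using X by auto
  have wf: "wf_variety V" using V by (simp add: mci_def)
  note inv = fiber_product_inv[OF P R S d \<phi>]
  have XM2: "act_dot \<beta> (\<phi> s) p' = p \<otimes>\<^bsub>P\<^esub> p' \<otimes>\<^bsub>P\<^esub> inv\<^bsub>P\<^esub> p"
      "b \<in> binary V \<Longrightarrow> act_star \<beta> b (\<phi> s) p' = binop P b p p'"
    if "p \<in> carrier P" "p' \<in> carrier P" "d p = \<phi> s" for p p' s b
    using X that by (auto simp flip: that(3))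
  show ?thesis
    unfolding pullback_xmod.simps crossed_module.simps
    by (intro conjI ballI fiber_product_object[OF P R S d \<phi> wf] S snd_mor
        pullback_derived_action[OF assms])
      (auto simp: inv pullback_action_def fiber_product_sel XM2)
qed

lemma pullback_projection:
  assumes "\<phi> \<in> mor V S R"
  shows "xmod_morphism V (pullback_xmod (P, R, d, \<beta>) S \<phi>) (P, R, d, \<beta>) (fst, \<phi>)"
  unfolding pullback_xmod.simps xmod_morphism.simps
  by (intro conjI ballI fst_mor assms) (auto simp: pullback_action_def fiber_product_sel(1))

text \<open>
  Membership of \<open>(f x, \<mu> x)\<close> in the fiber product is the square \<open>\<partial> f = \<phi> \<mu>\<close>, and equivariance
  of \<open>\<mu>\<close> in the second component is XM1 for \<open>\<mu>\<close>. Extensionality removes the freedom of maps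
  outside the carrier.
\<close>

lemma pullback_universal:
  assumes X: "crossed_module V (X, S, \<mu>, \<alpha>)"
    and f: "xmod_morphism V (X, S, \<mu>, \<alpha>) (P, R, d, \<beta>) (f, \<phi>)"
  shows "\<exists>!fs. fs \<in> extensional (carrier X) \<and>
    xmod_morphism V (X, S, \<mu>, \<alpha>) (pullback_xmod (P, R, d, \<beta>) S \<phi>) (fs, id) \<and>
    xmod_mor_eq (X, S, \<mu>, \<alpha>) (xmod_comp (fst, \<phi>) (fs, id)) (f, \<phi>)"
proof (rule ex1I)
  let ?fs = "restrict (\<lambda>x. (f x, \<mu> x)) (carrier X)"
  have objX: "object V X" and \<mu>: "\<mu> \<in> mor V X S" and der: "derived_action V S X \<alpha>"
    using X by auto
  have "(\<lambda>x. (f x, \<mu> x)) \<in> mor V X (fiber_product P S d \<phi>)"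
    using f \<mu> by (intro mor_pair) auto
  then have "?fs \<in> mor V X (fiber_product P S d \<phi>)" by (rule mor_restrict[OF objX])
  then show "?fs \<in> extensional (carrier X) \<and>
    xmod_morphism V (X, S, \<mu>, \<alpha>) (pullback_xmod (P, R, d, \<beta>) S \<phi>) (?fs, id) \<and>
    xmod_mor_eq (X, S, \<mu>, \<alpha>) (xmod_comp (fst, \<phi>) (?fs, id)) (f, \<phi>)"
    using X f by (auto simp: mor_id pullback_action_def derived_action_closed[OF der])
  fix fs assume fs: "fs \<in> extensional (carrier X) \<and>
    xmod_morphism V (X, S, \<mu>, \<alpha>) (pullback_xmod (P, R, d, \<beta>) S \<phi>) (fs, id) \<and>
    xmod_mor_eq (X, S, \<mu>, \<alpha>) (xmod_comp (fst, \<phi>) (fs, id)) (f, \<phi>)"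
  show "fs = ?fs"
  proof (rule extensionalityI)
    fix x assume "x \<in> carrier X"
    with fs show "fs x = ?fs x" by (auto simp: prod_eq_iff)
  qed (use fs in auto)
qed

theorem mainTheorem2:
  fixes V :: "('u, 'b) variety"
    and P :: "('p, 'u, 'b) alg" and R :: "('r, 'u, 'b) alg" and S :: "('s, 'u, 'b) alg"
    and d :: "'p \<Rightarrow> 'r" and \<beta> :: "('r, 'p, 'b) act" and \<phi> :: "'s \<Rightarrow> 'r"
  assumes "mci V"
    and "crossed_module V (P, R, d, \<beta>)"
    and "object V S"
    and "\<phi> \<in> mor V S R"
  shows "crossed_module V (pullback_xmod (P, R, d, \<beta>) S \<phi>)
    \<and> xmod_morphism V (pullback_xmod (P, R, d, \<beta>) S \<phi>) (P, R, d, \<beta>) (fst, \<phi>)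
    \<and> (\<forall>(X :: ('x, 'u, 'b) alg) \<mu> \<alpha> f.
         crossed_module V (X, S, \<mu>, \<alpha>) \<and>
         xmod_morphism V (X, S, \<mu>, \<alpha>) (P, R, d, \<beta>) (f, \<phi>) \<longrightarrow>
         (\<exists>!fs. fs \<in> extensional (carrier X) \<and>
            xmod_morphism V (X, S, \<mu>, \<alpha>) (pullback_xmod (P, R, d, \<beta>) S \<phi>) (fs, id) \<and>
            xmod_mor_eq (X, S, \<mu>, \<alpha>) (xmod_comp (fst, \<phi>) (fs, id)) (f, \<phi>)))"
proof (intro conjI allI impI)
  show "crossed_module V (pullback_xmod (P, R, d, \<beta>) S \<phi>)"
    by (rule pullback_crossed_module[OF assms])
  show "xmod_morphism V (pullback_xmod (P, R, d, \<beta>) S \<phi>) (P, R, d, \<beta>) (fst, \<phi>)"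
    by (rule pullback_projection[OF assms(4)])
qed (elim conjE, rule pullback_universal, assumption+)

end
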